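(* Let $P\subset\mathbb{E}^2$ be a polytope, i.e. a (convex) polygon with non-empty interior, with $N\ge 3$ vertices $\nu_1,\dots,\nu_N$ and interior angles $\varphi_1,\dots,\varphi_N$, and let $k_{\nu_i}$ be the curvature of the polygon at the vertex $\nu_i$. Then $$\frac{1}{24\pi}\sum_{i=1}^N\frac{\pi^2-\varphi_i^2}{\varphi_i}=-\frac{N-2}{24}+\frac{\pi}{24}\sum_{i=1}^N\frac{1}{\pi-k_{\nu_i}}.$$
   Context: A polyhedral set is the intersection of finitely many closed half-spaces; a bounded polyhedral set is called a polytope (hence it is convex). For a polygon with consecutive vertices $\nu_1,\dots,\nu_N$ (indices read cyclically), the curvature $k_{\nu_i}$ at the vertex $\nu_i$ is the angle between the directions of the consecutive edge vectors $\overrightarrow{\nu_{i-1}\nu_i}$ and $\overrightarrow{\nu_i\nu_{i+1}}$ (the exterior angle). *)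

theory Defs
  imports "HOL-Analysis.Analysis"
begin

text \<open>Unoriented angle between two vectors, in \<open>[0, \<pi>]\<close> (intended for nonzero vectors).\<close>

definition vec_angle :: "'a::real_inner \<Rightarrow> 'a \<Rightarrow> real" where
  "vec_angle u v = arccos (u \<bullet> v / (norm u * norm v))"

text \<open>
  The points \<open>\<nu> 1, \<dots>, \<nu> N\<close> list every vertex of \<open>P\<close> exactly once, in consecutive order along
  the boundary (in either orientation). Indices are read cyclically, so \<open>\<nu>\<close> is \<open>N\<close>-periodic; in
  particular \<open>\<nu> 0 = \<nu> N\<close> and \<open>\<nu> (N + 1) = \<nu> 1\<close>.
\<close>

definition consecutive_vertices ::
    "(real ^ 2) set \<Rightarrow> nat \<Rightarrow> (nat \<Rightarrow> real ^ 2) \<Rightarrow> bool" where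
  "consecutive_vertices P N \<nu> \<longleftrightarrow>
     bij_betw \<nu> {1..N} {v. v extreme_point_of P} \<and>
     (\<forall>i. \<nu> (i + N) = \<nu> i) \<and>
     (\<forall>i\<in>{1..N}. closed_segment (\<nu> i) (\<nu> (i + 1)) edge_of P)"

text \<open>
  Both angles below are meant for indices \<open>i \<ge> 1\<close> (subtraction on \<^typ>\<open>nat\<close> truncates).
  In a convex polygon the interior angle at a vertex is at most \<open>\<pi>\<close>, hence it is the unoriented
  angle between the two sides leaving that vertex.
\<close>

definition interior_angle :: "(nat \<Rightarrow> real ^ 2) \<Rightarrow> nat \<Rightarrow> real" where
  "interior_angle \<nu> i = vec_angle (\<nu> (i - 1) - \<nu> i) (\<nu> (i + 1) - \<nu> i)"

definition vertex_curvature :: "(nat \<Rightarrow> real ^ 2) \<Rightarrow> nat \<Rightarrow> real" where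
  "vertex_curvature \<nu> i = vec_angle (\<nu> i - \<nu> (i - 1)) (\<nu> (i + 1) - \<nu> i)"

end

(*
  Since pi - k i = \<phi> i, the identity amounts to the angle sum of a convex polygon being
  (N - 2) * pi. The line through an edge has all other vertices strictly on one side. A Pluecker relation turns
  this into the statement that all triples i < j < l of vertices have the same orientation, a
  property that survives cutting off the last vertex; so the angle sum follows by induction from
  that of a triangle.
*)
theory Submission
  imports Defs
begin

section \<open>Sine, cosine and additivity of angles in the plane\<close>

definition cross2 :: "real ^ 2 \<Rightarrow> real ^ 2 \<Rightarrow> real" where
  "cross2 u v = u $ 1 * v $ 2 - u $ 2 * v $ 1"

lemma inner_2: "(u :: real ^ 2) \<bullet> v = u $ 1 * v $ 1 + u $ 2 * v $ 2"
  by (simp add: inner_vec_def sum_2)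

lemma norm_2_square: "(norm (u :: real ^ 2))\<^sup>2 = (u $ 1)\<^sup>2 + (u $ 2)\<^sup>2"
  unfolding power2_norm_eq_inner inner_2 by (simp add: power2_eq_square)

lemma cross2_swap: "cross2 v u = - cross2 u v"
  by (simp add: cross2_def)

lemma cross2_pos_imp_nonzero:
  assumes "cross2 u v > 0"
  shows "u \<noteq> 0" and "v \<noteq> 0"
  using assms by (auto simp: cross2_def)

text \<open>Cauchy-Schwarz; for a zero vector the quotient is \<open>0\<close> by the convention on
  division, so the rules for \<open>arccos\<close> apply to every pair of vectors.\<close>

lemma inner_div_norms_bounds:
  "- 1 \<le> u \<bullet> v / (norm u * norm v)" "u \<bullet> v / (norm u * norm v) \<le> 1"
proof -
  have "\<bar>u \<bullet> v / (norm u * norm v)\<bar> \<le> 1"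
    using Cauchy_Schwarz_ineq2[of u v] by (cases "u = 0 \<or> v = 0") (auto simp: abs_mult)
  thus "- 1 \<le> u \<bullet> v / (norm u * norm v)" "u \<bullet> v / (norm u * norm v) \<le> 1"
    by linarith+
qed

lemma vec_angle_bounds: "0 \<le> vec_angle u v" "vec_angle u v \<le> pi"
  unfolding vec_angle_def
  by (rule arccos_lbound arccos_ubound; rule inner_div_norms_bounds)+

lemma cos_vec_angle: "cos (vec_angle u v) = u \<bullet> v / (norm u * norm v)"
  unfolding vec_angle_def by (rule cos_arccos; rule inner_div_norms_bounds)

lemma vec_angle_commute: "vec_angle u v = vec_angle v u"
  by (simp add: vec_angle_def inner_commute mult.commute)

lemma vec_angle_minus_left: "vec_angle (- u) v = pi - vec_angle u v"
  using arccos_minus[OF inner_div_norms_bounds[of u v]] by (simp add: vec_angle_def)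

lemma vec_angle_minus_minus: "vec_angle (- u) (- v) = vec_angle u v"
  by (simp add: vec_angle_def)

text \<open>Lagrange's identity gives the square of the sine; both sides are nonnegative, the sine
  because angles lie in [0, \<pi>].\<close>

lemma sin_vec_angle:
  assumes "cross2 u v > 0"
  shows "sin (vec_angle u v) = cross2 u v / (norm u * norm v)"
proof -
  have nz: "norm u > 0" "norm v > 0"
    using cross2_pos_imp_nonzero[OF assms] by auto
  have "(cross2 u v)\<^sup>2 + (u \<bullet> v)\<^sup>2 = (norm u)\<^sup>2 * (norm v)\<^sup>2"
    unfolding norm_2_square cross2_def inner_2
    by (simp add: power2_eq_square algebra_simps)
  hence "1 = (cross2 u v / (norm u * norm v))\<^sup>2 + (u \<bullet> v / (norm u * norm v))\<^sup>2"
    using nz by (simp add: power_divide power_mult_distrib flip: add_divide_distrib)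
  hence "(sin (vec_angle u v))\<^sup>2 = (cross2 u v / (norm u * norm v))\<^sup>2"
    by (simp add: sin_squared_eq cos_vec_angle)
  moreover have "sin (vec_angle u v) \<ge> 0"
    using vec_angle_bounds by (rule sin_ge_zero)
  moreover have "cross2 u v / (norm u * norm v) \<ge> 0"
    using assms nz by simp
  ultimately show ?thesis
    by (rule power2_eq_imp_eq)
qed

text \<open>The addition formulas show that the sum has the cosine of the angle between
  \<open>u\<close> and \<open>w\<close>. Its positive sine confines it to [0, \<pi>], where the
  cosine is injective.\<close>

lemma vec_angle_add:
  assumes "cross2 u v > 0" "cross2 v w > 0" "cross2 u w > 0"
  shows "vec_angle u w = vec_angle u v + vec_angle v w"
proof -
  let ?s = "vec_angle u v + vec_angle v w"
  have nz: "norm u > 0" "norm v > 0" "norm w > 0"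
    using cross2_pos_imp_nonzero[OF assms(1)] cross2_pos_imp_nonzero[OF assms(2)] by auto
  \<comment> \<open>With vectors read as complex numbers, conj(u) v has real part
    \<open>u \<bullet> v\<close> and imaginary part \<open>cross2 u v\<close>. This is the real part
    of conj(u) v * conj(v) w = |v|^2 conj(u) w; the imaginary part serves for the sine
    below.\<close>
  have "(u \<bullet> v) * (v \<bullet> w) - cross2 u v * cross2 v w = (u \<bullet> w) * (norm v)\<^sup>2"
    unfolding norm_2_square cross2_def inner_2
    by (simp add: power2_eq_square algebra_simps)
  moreover have "cos ?s = ((u \<bullet> v) * (v \<bullet> w) - cross2 u v * cross2 v w)
      / (norm u * (norm v)\<^sup>2 * norm w)"
    by (simp add: cos_add cos_vec_angle sin_vec_angle assms diff_divide_distrib power2_eq_square mult_ac)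
  ultimately have cos: "cos ?s = cos (vec_angle u w)"
    using nz by (simp add: cos_vec_angle power2_eq_square)
  have "cross2 u v * (v \<bullet> w) + (u \<bullet> v) * cross2 v w = cross2 u w * (norm v)\<^sup>2"
    unfolding norm_2_square cross2_def inner_2
    by (simp add: power2_eq_square algebra_simps)
  moreover have "sin ?s = (cross2 u v * (v \<bullet> w) + (u \<bullet> v) * cross2 v w)
      / (norm u * (norm v)\<^sup>2 * norm w)"
    by (simp add: sin_add cos_vec_angle sin_vec_angle assms add_divide_distrib power2_eq_square mult_ac)
  ultimately have sin: "sin ?s > 0"
    using nz assms by simp
  have bnds: "0 \<le> ?s" "?s \<le> 2 * pi"
    using vec_angle_bounds[of u v] vec_angle_bounds[of v w] by auto
  \<comment> \<open>Beyond \<pi> the sine would be at most 0; the end point 2\<pi> is treated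
    separately because \<open>sin_le_zero\<close> excludes it.\<close>
  have "?s \<le> pi"
  proof (rule ccontr)
    assume "\<not> ?s \<le> pi"
    hence "sin ?s \<le> 0"
      using bnds by (cases "?s = 2 * pi") (auto intro!: sin_le_zero simp: less_le simp del: sin_add)
    with sin show False by simp
  qed
  thus ?thesis
    using cos bnds vec_angle_bounds[of u w] by (metis arccos_cos)
qed

text \<open>Only the sign of \<open>s\<close> matters: it lets one statement serve both orientations
  of the boundary. For negative \<open>s\<close> the vectors are taken in reverse order.\<close>

lemma vec_angle_add_oriented:
  assumes "s * cross2 u v > 0" "s * cross2 v w > 0" "s * cross2 u w > 0"
  shows "vec_angle u w = vec_angle u v + vec_angle v w"
proof (cases "s > 0")
  case True
  thus ?thesis using assms by (intro vec_angle_add) (auto simp: zero_less_mult_iff)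
next
  case False
  hence "vec_angle w u = vec_angle w v + vec_angle v u"
    using assms by (intro vec_angle_add)
      (auto simp: zero_less_mult_iff cross2_swap[of w] cross2_swap[of v u])
  thus ?thesis by (simp add: vec_angle_commute)
qed

section \<open>Orientation of point triples and the angle sum of an oriented polygon\<close>

definition orient :: "real ^ 2 \<Rightarrow> real ^ 2 \<Rightarrow> real ^ 2 \<Rightarrow> real" where
  "orient a b c = cross2 (b - a) (c - a)"

lemma orient_rotate: "orient b c a = orient a b c"
  unfolding orient_def cross2_def by (simp add: algebra_simps)

definition angle3 :: "real ^ 2 \<Rightarrow> real ^ 2 \<Rightarrow> real ^ 2 \<Rightarrow> real" where
  "angle3 a b c = vec_angle (a - b) (c - b)"

lemma angle3_add:
  assumes "s * orient b a c > 0" "s * orient b c d > 0" "s * orient b a d > 0"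
  shows "angle3 a b d = angle3 a b c + angle3 c b d"
  using assms unfolding angle3_def orient_def by (rule vec_angle_add_oriented)

text \<open>The angle at \<open>a\<close> is the turn from \<open>b - a\<close> to
  \<open>c - a\<close>; the angle at \<open>c\<close>, with both sides reversed, is the turn from
  \<open>c - a\<close> to \<open>c - b\<close>. Together they form the exterior angle at
  \<open>b\<close>.\<close>

lemma triangle_angle_sum:
  assumes "s * orient a b c > 0"
  shows "angle3 c a b + angle3 a b c + angle3 b c a = pi"
proof -
  have "vec_angle (b - a) (c - b) = vec_angle (b - a) (c - a) + vec_angle (c - a) (c - b)"
    using assms unfolding orient_def
    by (intro vec_angle_add_oriented[of s]) (simp_all add: cross2_def algebra_simps)
  moreover have "vec_angle (a - b) (c - b) = pi - vec_angle (b - a) (c - b)"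
    using vec_angle_minus_left[of "b - a" "c - b"] by simp
  moreover have "vec_angle (b - c) (a - c) = vec_angle (c - a) (c - b)"
    using vec_angle_minus_minus[of "c - b" "c - a"] by (simp add: vec_angle_commute)
  ultimately show ?thesis
    by (simp add: angle3_def vec_angle_commute)
qed

text \<open>Seen from \<open>a\<close>, the points \<open>p\<close>, \<open>q\<close>,
  \<open>r\<close> lie on one side of the line through \<open>a\<close> and \<open>b\<close>, so
  turning about \<open>a\<close> orders them linearly. The Pluecker relation for the four vectors
  from \<open>a\<close> expresses this algebraically.\<close>

lemma orient_transitive:
  assumes "s * orient a b p > 0" "s * orient a b q > 0" "s * orient a b r > 0"
    and "s * orient a p q > 0" "s * orient a q r > 0"
  shows "s * orient a p r > 0"
proof -
  have pluecker: "(s * orient a b q) * (s * orient a p r) =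
      (s * orient a b p) * (s * orient a q r) + (s * orient a b r) * (s * orient a p q)"
    unfolding orient_def cross2_def by (simp add: algebra_simps)
  have "(s * orient a b q) * (s * orient a p r) > 0"
    unfolding pluecker
    by (rule add_pos_pos[OF mult_pos_pos[OF assms(1,5)] mult_pos_pos[OF assms(3,4)]])
  from this assms(2) show ?thesis by (rule zero_less_mult_pos)
qed

text \<open>Induction on \<open>l\<close> with \<open>i\<close> and \<open>j\<close> fixed: the edge
  from \<open>l\<close> to \<open>l + 1\<close> orients the triple \<open>i\<close>,
  \<open>l\<close>, \<open>l + 1\<close>, and transitivity around \<open>\<nu> i\<close> joins it to
  the triple \<open>i\<close>, \<open>j\<close>, \<open>l\<close>.\<close>

lemma oriented_triples:
  fixes \<nu> :: "nat \<Rightarrow> real ^ 2"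
  assumes edges: "\<And>i j. \<lbrakk>1 \<le> i; i < N; j \<in> {1..N}; j \<noteq> i; j \<noteq> i + 1\<rbrakk>
      \<Longrightarrow> s * orient (\<nu> i) (\<nu> (i + 1)) (\<nu> j) > 0"
    and "1 \<le> i" "i < j" "j < l" "l \<le> N"
  shows "s * orient (\<nu> i) (\<nu> j) (\<nu> l) > 0"
\<comment> \<open>\<open>\<nu> (i + 1)\<close> is the reference point in
  \<open>orient_transitive\<close> and must differ from \<open>\<nu> j\<close>; this case is the
  edge hypothesis itself.\<close>
proof (cases "j = i + 1")
  case True
  thus ?thesis using edges[of i l] assms by auto
next
  case False
  have "Suc j \<le> l" using assms by simp
  thus ?thesis using \<open>l \<le> N\<close>
  proof (induction l rule: dec_induct)
    case base
    have "s * orient (\<nu> j) (\<nu> (j + 1)) (\<nu> i) > 0"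
      using base assms(2-) by (intro edges) auto
    thus ?case by (metis orient_rotate Suc_eq_plus1)
  next
    case (step l)
    have *: "s * orient (\<nu> i) (\<nu> (i + 1)) (\<nu> m) > 0" if "i + 1 < m" "m \<le> N" for m
      using that assms(2-) by (intro edges) auto
    have "s * orient (\<nu> l) (\<nu> (l + 1)) (\<nu> i) > 0"
      using step assms(2-) by (intro edges) auto
    hence "s * orient (\<nu> i) (\<nu> l) (\<nu> (Suc l)) > 0"
      by (metis orient_rotate Suc_eq_plus1)
    moreover have "s * orient (\<nu> i) (\<nu> j) (\<nu> l) > 0"
      using step by auto
    moreover have "i + 1 < j" "j < l" "l < N"
      using False assms(3) step by auto
    ultimately show ?case
      using *[of j] *[of l] *[of "Suc l"]
        orient_transitive[of s "\<nu> i" "\<nu> (i + 1)" "\<nu> j" "\<nu> l" "\<nu> (Suc l)"] by simp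
  qed
qed

text \<open>In the induction step the diagonal from \<open>\<nu> 1\<close> to \<open>\<nu> n\<close>
  cuts off the triangle with apex \<open>\<nu> (n + 1)\<close>. The angles at the first and last
  vertex stand outside the sum because their neighbours change with \<open>n\<close>.\<close>

lemma oriented_polygon_angle_sum:
  fixes \<nu> :: "nat \<Rightarrow> real ^ 2"
  assumes "3 \<le> n"
    and "\<And>i j l. \<lbrakk>1 \<le> i; i < j; j < l; l \<le> n\<rbrakk> \<Longrightarrow> s * orient (\<nu> i) (\<nu> j) (\<nu> l) > 0"
  shows "angle3 (\<nu> n) (\<nu> 1) (\<nu> 2) + (\<Sum>i=2..<n. angle3 (\<nu> (i - 1)) (\<nu> i) (\<nu> (i + 1)))
    + angle3 (\<nu> (n - 1)) (\<nu> n) (\<nu> 1) = (real n - 2) * pi"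
  using assms
proof (induction n rule: dec_induct)
  case base
  have "s * orient (\<nu> 1) (\<nu> 2) (\<nu> 3) > 0"
    using base by simp
  from triangle_angle_sum[OF this] show ?case
    by (simp add: numeral_eq_Suc)
next
  case (step n)
  have sym: "angle3 a b c = angle3 c b a" for a b c
    by (simp add: angle3_def vec_angle_commute)
  have pos: "s * orient (\<nu> i) (\<nu> j) (\<nu> l) > 0" if "1 \<le> i" "i < j" "j < l" "l \<le> n + 1" for i j l
    using step.prems that by simp
  \<comment> \<open>The diagonal splits the angle at \<open>\<nu> 1\<close>, and next the one at
    \<open>\<nu> n\<close>, into a piece in the smaller polygon and a piece in the triangle.\<close>
  have "angle3 (\<nu> 2) (\<nu> 1) (\<nu> (n + 1)) =
      angle3 (\<nu> 2) (\<nu> 1) (\<nu> n) + angle3 (\<nu> n) (\<nu> 1) (\<nu> (n + 1))"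
    using step.hyps by (intro angle3_add[of s] pos) auto
  moreover have "angle3 (\<nu> (n + 1)) (\<nu> n) (\<nu> (n - 1)) =
      angle3 (\<nu> (n + 1)) (\<nu> n) (\<nu> 1) + angle3 (\<nu> 1) (\<nu> n) (\<nu> (n - 1))"
  proof (rule angle3_add[of s])
    have "s * orient (\<nu> 1) (\<nu> n) (\<nu> (n + 1)) > 0"
      using step.hyps by (intro pos) auto
    thus "s * orient (\<nu> n) (\<nu> (n + 1)) (\<nu> 1) > 0"
      by (metis orient_rotate Suc_eq_plus1)
    have "s * orient (\<nu> 1) (\<nu> (n - 1)) (\<nu> n) > 0"
      using step.hyps by (intro pos) auto
    thus "s * orient (\<nu> n) (\<nu> 1) (\<nu> (n - 1)) > 0"
      by (metis orient_rotate Suc_eq_plus1)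
    have "s * orient (\<nu> (n - 1)) (\<nu> n) (\<nu> (n + 1)) > 0"
      using step.hyps by (intro pos) auto
    thus "s * orient (\<nu> n) (\<nu> (n + 1)) (\<nu> (n - 1)) > 0"
      by (metis orient_rotate Suc_eq_plus1)
  qed
  moreover have "angle3 (\<nu> (n + 1)) (\<nu> 1) (\<nu> n) + angle3 (\<nu> 1) (\<nu> n) (\<nu> (n + 1))
      + angle3 (\<nu> n) (\<nu> (n + 1)) (\<nu> 1) = pi"
    using step.hyps by (intro triangle_angle_sum[of s] pos) auto
  moreover have "angle3 (\<nu> n) (\<nu> 1) (\<nu> 2) + (\<Sum>i=2..<n. angle3 (\<nu> (i - 1)) (\<nu> i) (\<nu> (i + 1)))
    + angle3 (\<nu> (n - 1)) (\<nu> n) (\<nu> 1) = (real n - 2) * pi"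
    using pos by (intro step.IH) auto
  moreover have "(\<Sum>i=2..<Suc n. angle3 (\<nu> (i - 1)) (\<nu> i) (\<nu> (i + 1))) =
      (\<Sum>i=2..<n. angle3 (\<nu> (i - 1)) (\<nu> i) (\<nu> (i + 1))) + angle3 (\<nu> (n - 1)) (\<nu> n) (\<nu> (n + 1))"
    using step.hyps by simp
  ultimately show ?case
    by (simp add: sym algebra_simps)
qed

section \<open>From edges of the polytope to a common orientation\<close>

text \<open>Since the edge is an exposed face, some linear functional attains its maximum on
  \<open>P\<close> exactly there. An extreme point of \<open>P\<close> on the edge is extreme in the
  segment, hence an end point, so at all others the functional is strictly smaller.\<close>

lemma edge_one_side:
  assumes "polyhedron P" and edge: "closed_segment a b edge_of P" and "a \<noteq> b"
  obtains t where
    "\<And>v. \<lbrakk>v extreme_point_of P; v \<noteq> a; v \<noteq> b\<rbrakk> \<Longrightarrow> t * orient a b v > 0"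
proof -
  have face: "closed_segment a b face_of P"
    using edge by (simp add: edge_of_def)
  hence "closed_segment a b exposed_face_of P"
    using assms(1) by (simp add: exposed_face_of_polyhedron)
  then obtain c d where sub: "P \<subseteq> {x. c \<bullet> x \<le> d}" and eq: "closed_segment a b = P \<inter> {x. c \<bullet> x = d}"
    unfolding exposed_face_of_def by blast
  have "c \<bullet> a = d" "c \<bullet> b = d"
    using eq ends_in_segment[of a b] by blast+
  hence perp: "c \<bullet> (b - a) = 0"
    by (simp add: inner_diff_right)
  \<comment> \<open>As \<open>c\<close> is orthogonal to \<open>b - a\<close>, this choice makes
    \<open>t * orient a b v\<close> equal to minus \<open>c \<bullet> (v - a)\<close> times the
    squared length of the edge.\<close>
  define t where "t = cross2 c (b - a)"
  have "t * orient a b v > 0" if v: "v extreme_point_of P" "v \<noteq> a" "v \<noteq> b" for v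
  proof -
    have "v \<notin> closed_segment a b"
      using v extreme_point_of_face[OF face, of v] extreme_point_of_segment[of v a b] by blast
    moreover have "v \<in> P"
      using v by (simp add: extreme_point_of_def)
    ultimately have "c \<bullet> v < d"
      using sub eq by (force simp: less_le)
    hence neg: "c \<bullet> (v - a) < 0"
      using \<open>c \<bullet> a = d\<close> by (simp add: inner_diff_right)
    have "t * orient a b v =
        (c \<bullet> (b - a)) * ((b - a) \<bullet> (v - a)) - (c \<bullet> (v - a)) * (norm (b - a))\<^sup>2"
      unfolding t_def orient_def cross2_def inner_2 norm_2_square
      by (simp add: power2_eq_square algebra_simps)
    thus ?thesis
      using neg perp \<open>a \<noteq> b\<close> by (simp add: mult_neg_pos)
  qed
  thus thesis by (rule that)
qed

text \<open>Each edge comes with its own sign; neighbouring edges share a triple of consecutive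
  vertices, which forces their signs to agree.\<close>

lemma consecutive_vertices_oriented:
  assumes "polyhedron P" "N \<ge> 3" and cv: "consecutive_vertices P N \<nu>"
  obtains s where "\<And>i j l. \<lbrakk>1 \<le> i; i < j; j < l; l \<le> N\<rbrakk> \<Longrightarrow> s * orient (\<nu> i) (\<nu> j) (\<nu> l) > 0"
proof -
  have inj: "inj_on \<nu> {1..N}" and ext: "\<nu> ` {1..N} = {v. v extreme_point_of P}"
    and edge: "\<And>i. i \<in> {1..N} \<Longrightarrow> closed_segment (\<nu> i) (\<nu> (i + 1)) edge_of P"
    using cv by (auto simp: consecutive_vertices_def bij_betw_def)
  have neq: "\<nu> i \<noteq> \<nu> j" if "i \<in> {1..N}" "j \<in> {1..N}" "i \<noteq> j" for i j
    using inj that by (auto dest: inj_onD)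
  have side: "\<exists>t. \<forall>j\<in>{1..N} - {i, i + 1}. t * orient (\<nu> i) (\<nu> (i + 1)) (\<nu> j) > 0"
    if i: "1 \<le> i" "i < N" for i
  proof -
    have "closed_segment (\<nu> i) (\<nu> (i + 1)) edge_of P" "\<nu> i \<noteq> \<nu> (i + 1)"
      using i edge[of i] neq[of i "i + 1"] by auto
    from edge_one_side[OF assms(1) this] obtain t where
      t: "\<And>v. \<lbrakk>v extreme_point_of P; v \<noteq> \<nu> i; v \<noteq> \<nu> (i + 1)\<rbrakk>
        \<Longrightarrow> t * orient (\<nu> i) (\<nu> (i + 1)) v > 0"
      by blast
    have "t * orient (\<nu> i) (\<nu> (i + 1)) (\<nu> j) > 0" if "j \<in> {1..N} - {i, i + 1}" for j
      using that i ext by (intro t neq) auto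
    thus ?thesis by blast
  qed
  obtain s where s: "\<forall>j\<in>{1..N} - {1, 1 + 1}. s * orient (\<nu> 1) (\<nu> (1 + 1)) (\<nu> j) > 0"
    using side[of 1] \<open>N \<ge> 3\<close> by auto
  have all: "\<forall>j\<in>{1..N} - {i, i + 1}. s * orient (\<nu> i) (\<nu> (i + 1)) (\<nu> j) > 0"
    if "1 \<le> i" "i < N" for i
    using that
  proof (induction i rule: dec_induct)
    case base
    show ?case by (rule s)
  next
    case (step i)
    obtain t where
      t: "\<forall>j\<in>{1..N} - {Suc i, Suc i + 1}. t * orient (\<nu> (Suc i)) (\<nu> (Suc i + 1)) (\<nu> j) > 0"
      using side[of "Suc i"] step by auto
    \<comment> \<open>The triangle common to both edges: rotating its vertices keeps the
      orientation, so \<open>s\<close> and \<open>t\<close> have the same sign.\<close>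
    let ?o = "orient (\<nu> i) (\<nu> (i + 1)) (\<nu> (Suc i + 1))"
    have "s * ?o > 0"
      using step by auto
    moreover have "t * orient (\<nu> (Suc i)) (\<nu> (Suc i + 1)) (\<nu> i) > 0"
      using t step by auto
    hence "t * ?o > 0"
      by (metis orient_rotate Suc_eq_plus1)
    ultimately have "(s > 0) = (t > 0)" "(s < 0) = (t < 0)"
      by (auto simp: zero_less_mult_iff)
    with t show ?case
      by (auto simp: zero_less_mult_iff)
  qed
  have "s * orient (\<nu> i) (\<nu> j) (\<nu> l) > 0" if "1 \<le> i" "i < j" "j < l" "l \<le> N" for i j l
    by (rule oriented_triples[of N s \<nu>]) (use all that in simp_all)
  thus thesis by (rule that)
qed

section \<open>Interior angles, curvature and the identity\<close>

lemma interior_angle_sum: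
  assumes "polyhedron P" "N \<ge> 3" and cv: "consecutive_vertices P N \<nu>"
  shows "(\<Sum>i=1..N. interior_angle \<nu> i) = (real N - 2) * pi"
proof -
  obtain s where "\<And>i j l. \<lbrakk>1 \<le> i; i < j; j < l; l \<le> N\<rbrakk> \<Longrightarrow> s * orient (\<nu> i) (\<nu> j) (\<nu> l) > 0"
    using consecutive_vertices_oriented[OF assms] by blast
  from oriented_polygon_angle_sum[OF \<open>N \<ge> 3\<close> this]
  have "angle3 (\<nu> N) (\<nu> 1) (\<nu> 2) + (\<Sum>i=2..<N. interior_angle \<nu> i)
    + angle3 (\<nu> (N - 1)) (\<nu> N) (\<nu> 1) = (real N - 2) * pi"
    by (simp add: angle3_def interior_angle_def)
  \<comment> \<open>The interior angles at \<open>1\<close> and \<open>N\<close> refer to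
    \<open>\<nu> 0\<close> and \<open>\<nu> (N + 1)\<close>; periodicity turns these into
    \<open>\<nu> N\<close> and \<open>\<nu> 1\<close>.\<close>
  moreover have "\<nu> (i + N) = \<nu> i" for i
    using cv by (simp add: consecutive_vertices_def)
  from this[of 0] this[of 1] have "\<nu> 0 = \<nu> N" "\<nu> (N + 1) = \<nu> 1"
    by simp_all
  hence "angle3 (\<nu> N) (\<nu> 1) (\<nu> 2) = interior_angle \<nu> 1"
    "angle3 (\<nu> (N - 1)) (\<nu> N) (\<nu> 1) = interior_angle \<nu> N"
    by (simp_all add: angle3_def interior_angle_def numeral_2_eq_2)
  moreover have "{1..N} = insert 1 (insert N {2..<N})"
    using \<open>N \<ge> 3\<close> by auto
  ultimately show ?thesis
    using \<open>N \<ge> 3\<close> by simp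
qed

text \<open>Reversing the incoming edge vector replaces the angle by its supplement.\<close>

lemma interior_angle_eq: "interior_angle \<nu> i = pi - vertex_curvature \<nu> i"
  using vec_angle_minus_left[of "\<nu> i - \<nu> (i - 1)" "\<nu> (i + 1) - \<nu> i"]
  by (simp add: interior_angle_def vertex_curvature_def)

theorem mainTheorem2:
  fixes P :: "(real ^ 2) set" and N :: nat and \<nu> :: "nat \<Rightarrow> real ^ 2"
    and \<phi> k :: "nat \<Rightarrow> real"
  assumes "polyhedron P" and "bounded P" and "interior P \<noteq> {}"
    and "N \<ge> 3"
    and "consecutive_vertices P N \<nu>"
    and "\<And>i. i \<in> {1..N} \<Longrightarrow> \<phi> i = interior_angle \<nu> i"
    and "\<And>i. i \<in> {1..N} \<Longrightarrow> k i = vertex_curvature \<nu> i"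
  shows "1 / (24 * pi) * (\<Sum>i=1..N. (pi\<^sup>2 - (\<phi> i)\<^sup>2) / \<phi> i) =
         - ((real N - 2) / 24) + pi / 24 * (\<Sum>i=1..N. 1 / (pi - k i))"
proof -
  have sum: "(\<Sum>i=1..N. \<phi> i) = (real N - 2) * pi"
    using interior_angle_sum[OF assms(1,4,5)] assms(6) by simp
  \<comment> \<open>When \<open>\<phi> i = 0\<close>, both quotients are \<open>0\<close>, so positivity of the angles is not an issue.\<close>
  have "(pi\<^sup>2 - (\<phi> i)\<^sup>2) / \<phi> i = pi\<^sup>2 * (1 / (pi - k i)) - \<phi> i" if "i \<in> {1..N}" for i
    using assms(6,7)[OF that] interior_angle_eq[of \<nu> i]
    by (simp add: diff_divide_distrib power2_eq_square)
  \<comment> \<open>The subtracted terms \<open>\<phi> i\<close> add up to the angle sum, which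
    division by 24\<pi> turns into (N - 2)/24.\<close>
  hence "(\<Sum>i=1..N. (pi\<^sup>2 - (\<phi> i)\<^sup>2) / \<phi> i) =
      pi\<^sup>2 * (\<Sum>i=1..N. 1 / (pi - k i)) - (real N - 2) * pi"
    by (simp add: sum_subtractf sum[simplified] sum_distrib_left)
  thus ?thesis
    by (simp add: field_simps power2_eq_square)
qed

end
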